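(* Let $(X,\mathcal{X})$ be an unbounded large scale space, and let $G$ be a group that acts on $X$ coarsely discontinuously by coarse equivalences. If $(X,\mathcal{X})$ is coarsely one-ended, then there is a canonical group isomorphism $G\cong \mathsf{Aut}(X/X_G)$.
   Context: For $B\subseteq X$ and a family $\mathcal{U}$ of subsets of $X$, the star $\mathrm{st}(B,\mathcal{U})$ is the union of the elements of $\mathcal{U}$ that intersect $B$; for families, $\mathrm{st}(\mathcal{B},\mathcal{U})=\{\mathrm{st}(B,\mathcal{U})\mid B\in\mathcal{B}\}$. A large scale structure $\mathcal{L}$ on a set $X$ is a nonempty set of families of subsets of $X$ (called the uniformly bounded families) such that: (1) if $\mathcal{B}_1\in\mathcal{L}$ and each element of $\mathcal{B}_2$ consisting of more than one point is contained in some element of $\mathcal{B}_1$, then $\mathcal{B}_2\in\mathcal{L}$; (2) $\mathcal{B}_1,\mathcal{B}_2\in\mathcal{L}$ implies $\mathrm{st}(\mathcal{B}_1,\mathcal{B}_2)\in\mathcal{L}$. A large scale space is a set with a large scale structure. The large scale structure generated by a collection of families is the smallest one containing it. A subset is bounded if it is an element of some uniformly bounded family; $X$ is unbounded if $X$ itself is not bounded. A map $f:X\to Y$ of large scale spaces is large scale continuous if $f(\mathcal{U})=\{f(U)\mid U\in\mathcal{U}\}$ is uniformly bounded for every uniformly bounded $\mathcal{U}$. Maps $f,g:X\to Y$ are close if $\{\{f(x),g(x)\}\mid x\in X\}$ is uniformly bounded in $Y$. A large scale continuous map $f$ is a coarse equivalence if $Y\subseteq\mathrm{st}(f(X),\mathcal{V})$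 for some uniformly bounded $\mathcal{V}$ in $Y$, and $\{f^{-1}(V)\mid V\in\mathcal{V}\}$ is uniformly bounded in $X$ for every uniformly bounded $\mathcal{V}$ in $Y$. An action of $G$ on $X$ by coarse equivalences is an action on the underlying set such that every $g\in G$ acts as a large scale continuous map. The action is coarsely discontinuous if for every uniformly bounded family $\mathcal{U}$ and every $g\in G\setminus\{e\}$ there is a bounded set $K$ such that $U\cap g\cdot U=\varnothing$ for every $U\in\mathcal{U}$ with $U\cap K=\varnothing$. $X_G$ denotes the set $X$ with the large scale structure generated by $\mathcal{X}$ together with all families $\{\{x,gx\}\mid x\in X\}$, $g\in G$. $\mathsf{Aut}(X/X_G)$ is the group, under composition, of coarse equivalences $X\to X$ which are close to the identity when considered as maps on $X_G$, where two such maps are identified if they are close as maps on $X$. For a cover $\mathcal{U}$ of a set $A$, the $\mathcal{U}$-component of $x\in A$ is the set of all $x'\in A$ for which there are $U_0,\dots,U_n\in\mathcal{U}$ with $x\in U_0$, $x'\in U_n$ and $U_i\cap U_{i+1}\neq\varnothing$ for $0\le i<n$. If $\mathcal{U}$ is a cover of $X$ and $A\subseteq X$, then $A$ is called $\mathcal{U}$-connected if it has at most one component with respect to the restricted cover $\{U\cap A\mid U\in\mathcal{U}\}$ of $A$. $X$ is coarsely one-ended if there is a uniformly bounded cover $\mathcal{U}$ of $X$ such that for every bounded set $K$ there is a bounded set $K'\supseteq K$ with $X\setminus K'$ $\mathcal{U}$-connected. *)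

theory Defs
  imports "HOL-Algebra.Group_Action"
begin

section \<open>Large scale spaces\<close>

definition star :: "'a set \<Rightarrow> 'a set set \<Rightarrow> 'a set" where
  "star B \<U> = \<Union>{U \<in> \<U>. U \<inter> B \<noteq> {}}"

definition star_family :: "'a set set \<Rightarrow> 'a set set \<Rightarrow> 'a set set" where
  "star_family \<B> \<U> = (\<lambda>B. star B \<U>) ` \<B>"

locale large_scale_space =
  fixes X :: "'a set" and L :: "'a set set set"
  assumes families: "L \<subseteq> Pow (Pow X)"
    and nonempty: "L \<noteq> {}"
    and refine: "\<lbrakk>\<B>\<^sub>1 \<in> L; \<B>\<^sub>2 \<subseteq> Pow X;
        \<And>B. \<lbrakk>B \<in> \<B>\<^sub>2; \<exists>x\<in>B. \<exists>y\<in>B. x \<noteq> y\<rbrakk> \<Longrightarrow> \<exists>B'\<in>\<B>\<^sub>1. B \<subseteq> B'\<rbrakk> \<Longrightarrow> \<B>\<^sub>2 \<in> L"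
    and star_closed: "\<lbrakk>\<B>\<^sub>1 \<in> L; \<B>\<^sub>2 \<in> L\<rbrakk> \<Longrightarrow> star_family \<B>\<^sub>1 \<B>\<^sub>2 \<in> L"

definition generated_ls :: "'a set \<Rightarrow> 'a set set set \<Rightarrow> 'a set set set" where
  "generated_ls X \<C> = \<Inter>{L. large_scale_space X L \<and> \<C> \<subseteq> L}"

definition ls_bounded :: "'a set set set \<Rightarrow> 'a set \<Rightarrow> bool" where
  "ls_bounded L K \<longleftrightarrow> (\<exists>\<U>\<in>L. K \<in> \<U>)"

section \<open>Maps\<close>

definition ls_continuous ::
  "'a set \<Rightarrow> 'a set set set \<Rightarrow> 'b set \<Rightarrow> 'b set set set \<Rightarrow> ('a \<Rightarrow> 'b) \<Rightarrow> bool" where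
  "ls_continuous X L Y M f \<longleftrightarrow> f \<in> X \<rightarrow> Y \<and> (\<forall>\<U>\<in>L. (\<lambda>U. f ` U) ` \<U> \<in> M)"

text \<open>Closeness of two maps from \<open>X\<close> to a large scale space with structure \<open>M\<close>; it does not
  involve a structure on \<open>X\<close>.\<close>

definition ls_close :: "'a set \<Rightarrow> 'b set set set \<Rightarrow> ('a \<Rightarrow> 'b) \<Rightarrow> ('a \<Rightarrow> 'b) \<Rightarrow> bool" where
  "ls_close X M f g \<longleftrightarrow> (\<lambda>x. {f x, g x}) ` X \<in> M"

definition coarse_equivalence ::
  "'a set \<Rightarrow> 'a set set set \<Rightarrow> 'b set \<Rightarrow> 'b set set set \<Rightarrow> ('a \<Rightarrow> 'b) \<Rightarrow> bool" where
  "coarse_equivalence X L Y M f \<longleftrightarrow>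
     ls_continuous X L Y M f \<and>
     (\<exists>\<V>\<in>M. Y \<subseteq> star (f ` X) \<V>) \<and>
     (\<forall>\<V>\<in>M. (\<lambda>V. f -` V \<inter> X) ` \<V> \<in> L)"

section \<open>Actions by coarse equivalences\<close>

definition acts_by_coarse_equivalences ::
  "('g, 'm) monoid_scheme \<Rightarrow> 'a set \<Rightarrow> 'a set set set \<Rightarrow> ('g \<Rightarrow> 'a \<Rightarrow> 'a) \<Rightarrow> bool" where
  "acts_by_coarse_equivalences G X L \<phi> \<longleftrightarrow>
     group_action G X \<phi> \<and> (\<forall>g\<in>carrier G. ls_continuous X L X L (\<phi> g))"

definition coarsely_discontinuous ::
  "('g, 'm) monoid_scheme \<Rightarrow> 'a set set set \<Rightarrow> ('g \<Rightarrow> 'a \<Rightarrow> 'a) \<Rightarrow> bool" where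
  "coarsely_discontinuous G L \<phi> \<longleftrightarrow>
     (\<forall>\<U>\<in>L. \<forall>g\<in>carrier G - {\<one>\<^bsub>G\<^esub>}.
        \<exists>K. ls_bounded L K \<and> (\<forall>U\<in>\<U>. U \<inter> K = {} \<longrightarrow> U \<inter> \<phi> g ` U = {}))"

definition quotient_ls ::
  "('g, 'm) monoid_scheme \<Rightarrow> 'a set \<Rightarrow> 'a set set set \<Rightarrow> ('g \<Rightarrow> 'a \<Rightarrow> 'a) \<Rightarrow> 'a set set set" where
  "quotient_ls G X L \<phi> =
     generated_ls X (L \<union> (\<lambda>g. (\<lambda>x. {x, \<phi> g x}) ` X) ` carrier G)"

section \<open>The automorphism group\<close>

text \<open>For two structures \<open>L\<close> and \<open>L'\<close> on \<open>X\<close>: coarse equivalences of \<open>(X, L)\<close> that are close to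
  the identity with respect to \<open>L'\<close>, up to closeness with respect to \<open>L\<close>. As in
  \<^const>\<open>BijGroup\<close>, maps \<open>X \<rightarrow> X\<close> are represented by extensional functions.\<close>

definition coarse_aut_maps ::
  "'a set \<Rightarrow> 'a set set set \<Rightarrow> 'a set set set \<Rightarrow> ('a \<Rightarrow> 'a) set" where
  "coarse_aut_maps X L L' =
     {f \<in> X \<rightarrow>\<^sub>E X. coarse_equivalence X L X L f \<and> ls_close X L' f (\<lambda>x. x)}"

definition coarse_aut_rel ::
  "'a set \<Rightarrow> 'a set set set \<Rightarrow> 'a set set set \<Rightarrow> (('a \<Rightarrow> 'a) \<times> ('a \<Rightarrow> 'a)) set" where
  "coarse_aut_rel X L L' =
     {(f, g). f \<in> coarse_aut_maps X L L' \<and> g \<in> coarse_aut_maps X L L' \<and> ls_close X L f g}"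

definition coarse_aut_class ::
  "'a set \<Rightarrow> 'a set set set \<Rightarrow> 'a set set set \<Rightarrow> ('a \<Rightarrow> 'a) \<Rightarrow> ('a \<Rightarrow> 'a) set" where
  "coarse_aut_class X L L' f = coarse_aut_rel X L L' `` {f}"

definition coarse_Aut ::
  "'a set \<Rightarrow> 'a set set set \<Rightarrow> 'a set set set \<Rightarrow> ('a \<Rightarrow> 'a) set monoid" where
  "coarse_Aut X L L' =
     \<lparr>carrier = coarse_aut_maps X L L' // coarse_aut_rel X L L',
      mult = (\<lambda>A B. \<Union>f\<in>A. \<Union>g\<in>B. coarse_aut_class X L L' (compose X f g)),
      one = coarse_aut_class X L L' (\<lambda>x\<in>X. x)\<rparr>"

section \<open>Coarse ends\<close>

definition cover_component :: "'a set set \<Rightarrow> 'a \<Rightarrow> 'a set" where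
  "cover_component \<U> x =
     {x'. \<exists>(n::nat) U. (\<forall>i\<le>n. U i \<in> \<U>) \<and> x \<in> U 0 \<and> x' \<in> U n \<and>
            (\<forall>i<n. U i \<inter> U (Suc i) \<noteq> {})}"

definition cover_connected :: "'a set set \<Rightarrow> 'a set \<Rightarrow> bool" where
  "cover_connected \<U> A \<longleftrightarrow>
     (\<forall>x\<in>A. \<forall>y\<in>A. cover_component ((\<lambda>U. U \<inter> A) ` \<U>) x = cover_component ((\<lambda>U. U \<inter> A) ` \<U>) y)"

definition coarsely_one_ended :: "'a set \<Rightarrow> 'a set set set \<Rightarrow> bool" where
  "coarsely_one_ended X L \<longleftrightarrow>
     (\<exists>\<U>\<in>L. \<Union>\<U> = X \<and>
        (\<forall>K. ls_bounded L K \<longrightarrow>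
           (\<exists>K'. ls_bounded L K' \<and> K \<subseteq> K' \<and> cover_connected \<U> (X - K'))))"

end

theory Submission
  imports Defs
begin

text \<open>A large scale structure is determined by its controlled sets of pairs. A map \<open>f\<close> that is
  close to the identity on \<open>X\<^sub>G\<close> satisfies: for every \<open>x\<close>, the point \<open>f x\<close> is uniformly close to
  \<open>g x\<close> for some \<open>g\<close> in a fixed finite \<open>F \<subseteq> G\<close>. By coarse discontinuity, two neighbouring points at
  which different elements of \<open>F\<close> do the job lie in a bounded set, because \<open>g\<close> and \<open>h\<close> are far apart
  outside of a bounded set whenever \<open>g \<noteq> h\<close>. The complement of a suitable larger bounded set is
  connected by one-endedness, so a single \<open>g\<close> works on it, and \<open>f\<close> is close to \<open>g\<close>.\<close>

section \<open>Controlled sets\<close>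

text \<open>The entourages of the coarse structure that corresponds to \<open>L\<close>. Turning a
  pair into the set \<open>{x, y}\<close> forgets its order, so converses are controlled at once,
  while ordered pairs still allow relational composition.\<close>

definition controlled :: "'a set set set \<Rightarrow> ('a \<times> 'a) set \<Rightarrow> bool" where
  "controlled L E \<longleftrightarrow> (\<lambda>(x, y). {x, y}) ` E \<in> L"

lemma in_starI: "U \<in> \<U> \<Longrightarrow> x \<in> B \<Longrightarrow> x \<in> U \<Longrightarrow> y \<in> U \<Longrightarrow> y \<in> star B \<U>"
  by (auto simp: star_def)

lemma map_prod_image_Times: "map_prod f g ` (A \<times> B) = f ` A \<times> g ` B"
  by (rule map_prod_surj_on) simp_all

context large_scale_space
begin

lemma controlled_subset_X: "controlled L E \<Longrightarrow> E \<subseteq> X \<times> X"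
  using families by (fastforce simp: controlled_def)

lemma singletons_in: "(\<lambda>x. {x}) ` X \<in> L"
  using nonempty refine[of _ "(\<lambda>x. {x}) ` X"] by fastforce

text \<open>Stars produce unions once singletons are added to both families: a member of
  \<open>\<B>\<close> lies in its own star because of the singletons of its points, and a member of
  \<open>\<C>\<close> containing \<open>x\<close> lies in the star of \<open>{x}\<close>.\<close>

lemma Un_in:
  assumes "\<B> \<in> L" "\<C> \<in> L"
  shows "\<B> \<union> \<C> \<in> L"
proof -
  let ?S = "(\<lambda>x. {x}) ` X"
  have sub: "\<B> \<subseteq> Pow X" "\<C> \<subseteq> Pow X"
    using assms families by auto
  have B: "\<B> \<union> ?S \<in> L"
    by (rule refine[OF assms(1)]) (use sub in auto)
  have C: "\<C> \<union> ?S \<in> L"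
    by (rule refine[OF assms(2)]) (use sub in auto)
  show ?thesis
  proof (rule refine[OF star_closed[OF B C]])
    show "\<B> \<union> \<C> \<subseteq> Pow X"
      using sub by auto
    fix B assume B: "B \<in> \<B> \<union> \<C>" and "\<exists>x\<in>B. \<exists>y\<in>B. x \<noteq> y"
    then obtain x where x: "x \<in> B" by auto
    show "\<exists>B'\<in>star_family (\<B> \<union> ?S) (\<C> \<union> ?S). B \<subseteq> B'"
    proof (cases "B \<in> \<B>")
      case True
      have "B \<subseteq> star B (\<C> \<union> ?S)"
      proof
        fix y assume y: "y \<in> B"
        then have "{y} \<in> \<C> \<union> ?S"
          using True sub by blast
        then show "y \<in> star B (\<C> \<union> ?S)"
          using y by (rule in_starI) simp_all
      qed
      then show ?thesis
        using True unfolding star_family_def by blast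
    next
      case False
      then have "B \<in> \<C> \<union> ?S" "{x} \<in> \<B> \<union> ?S"
        using B x sub by blast+
      moreover from this have "B \<subseteq> star {x} (\<C> \<union> ?S)"
        using x by (blast intro: in_starI)
      ultimately show ?thesis
        unfolding star_family_def by blast
    qed
  qed
qed

lemma controlled_mono:
  assumes E: "controlled L E" and sub: "D \<subseteq> E"
  shows "controlled L D"
  unfolding controlled_def
  by (rule refine[OF E[unfolded controlled_def]]) (use controlled_subset_X[OF E] sub in auto)

lemma controlled_Id: "controlled L (Id_on X)"
proof -
  have "(\<lambda>(x, y). {x, y}) ` Id_on X = (\<lambda>x. {x}) ` X"
    by (auto simp: image_iff Id_on_def)
  then show ?thesis
    using singletons_in by (simp add: controlled_def)
qed

lemma controlled_empty: "controlled L {}"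
  using controlled_mono[OF controlled_Id] by blast

lemma controlled_Un: "controlled L E \<Longrightarrow> controlled L D \<Longrightarrow> controlled L (E \<union> D)"
  by (simp add: controlled_def image_Un Un_in)

lemma controlled_UN:
  "finite I \<Longrightarrow> (\<And>i. i \<in> I \<Longrightarrow> controlled L (E i)) \<Longrightarrow> controlled L (\<Union>i\<in>I. E i)"
  by (induction I rule: finite_induct) (auto intro: controlled_empty controlled_Un)

lemma controlled_converse:
  assumes "controlled L E"
  shows "controlled L (E\<inverse>)"
proof -
  have "(\<lambda>(x, y). {x, y}) ` (E\<inverse>) = (\<lambda>(x, y). {x, y}) ` E"
    by (force simp: image_iff insert_commute)
  then show ?thesis
    using assms by (simp add: controlled_def)
qed

text \<open>The star of \<open>{x, y}\<close> with respect to the pairs from \<open>D\<close> and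
  the diagonal contains \<open>z\<close> through \<open>{y, z}\<close> and \<open>x\<close> through
  \<open>{x, x}\<close>.\<close>

lemma controlled_relcomp:
  assumes E: "controlled L E" and D: "controlled L D"
  shows "controlled L (E O D)"
proof -
  let ?p = "\<lambda>(x, y). {x, y}"
  have sub: "E \<subseteq> X \<times> X" "D \<subseteq> X \<times> X"
    using assms controlled_subset_X by auto
  have st: "star_family (?p ` E) (?p ` (D \<union> Id_on X)) \<in> L"
    using E controlled_Un[OF D controlled_Id] unfolding controlled_def by (rule star_closed)
  show ?thesis
    unfolding controlled_def
  proof (rule refine[OF st])
    show "?p ` (E O D) \<subseteq> Pow X"
      using sub by auto
    fix B assume "B \<in> ?p ` (E O D)"
    then obtain x y z where xyz: "(x, y) \<in> E" "(y, z) \<in> D" "B = {x, z}"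
      by auto
    then have "{x, x} \<in> ?p ` (D \<union> Id_on X)" "{y, z} \<in> ?p ` (D \<union> Id_on X)"
      using sub by (auto simp: image_iff)
    then have "x \<in> star {x, y} (?p ` (D \<union> Id_on X))" "z \<in> star {x, y} (?p ` (D \<union> Id_on X))"
      by (meson in_starI insertI1 insertI2 singletonI)+
    then have "B \<subseteq> star {x, y} (?p ` (D \<union> Id_on X))"
      using xyz by blast
    then show "\<exists>B'\<in>star_family (?p ` E) (?p ` (D \<union> Id_on X)). B \<subseteq> B'"
      using xyz(1) unfolding star_family_def by blast
  qed
qed

text \<open>The dictionary between families and entourages. Pairs from a member refine that member;
  conversely, a member \<open>B\<close> lies in the star of any of its points with respect to the
  family of these pairs.\<close>

lemma in_iff_controlled: "\<B> \<in> L \<longleftrightarrow> controlled L (\<Union>B\<in>\<B>. B \<times> B)"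
proof
  assume B: "\<B> \<in> L"
  show "controlled L (\<Union>B\<in>\<B>. B \<times> B)"
    unfolding controlled_def by (rule refine[OF B]) (use B families in auto)
next
  let ?p = "\<lambda>(x, y). {x, y}"
  assume E: "controlled L (\<Union>B\<in>\<B>. B \<times> B)"
  have sub: "\<B> \<subseteq> Pow X"
    using controlled_subset_X[OF E] by blast
  show "\<B> \<in> L"
  proof (rule refine[OF star_closed[OF singletons_in E[unfolded controlled_def]]])
    show "\<B> \<subseteq> Pow X" by fact
    fix B assume B: "B \<in> \<B>" and "\<exists>x\<in>B. \<exists>y\<in>B. x \<noteq> y"
    then obtain x where x: "x \<in> B" by auto
    have "B \<subseteq> star {x} (?p ` (\<Union>B\<in>\<B>. B \<times> B))"
    proof
      fix y assume "y \<in> B"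
      then have "{x, y} \<in> ?p ` (\<Union>B\<in>\<B>. B \<times> B)"
        using x B by (auto simp: image_iff)
      then show "y \<in> star {x} (?p ` (\<Union>B\<in>\<B>. B \<times> B))"
        by (rule in_starI[where x = x]) auto
    qed
    moreover have "x \<in> X"
      using x B sub by auto
    ultimately show "\<exists>B'\<in>star_family ((\<lambda>x. {x}) ` X) (?p ` (\<Union>B\<in>\<B>. B \<times> B)). B \<subseteq> B'"
      by (auto simp: star_family_def)
  qed
qed

lemma bounded_iff_controlled: "ls_bounded L K \<longleftrightarrow> controlled L (K \<times> K)"
proof
  assume "ls_bounded L K"
  then obtain \<U> where "\<U> \<in> L" "K \<in> \<U>"
    by (auto simp: ls_bounded_def)
  then show "controlled L (K \<times> K)"
    using in_iff_controlled[of \<U>] by (auto elim: controlled_mono)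
next
  assume "controlled L (K \<times> K)"
  then have "{K} \<in> L"
    using in_iff_controlled[of "{K}"] by simp
  then show "ls_bounded L K"
    by (auto simp: ls_bounded_def)
qed

lemma bounded_mono: "ls_bounded L K \<Longrightarrow> K' \<subseteq> K \<Longrightarrow> ls_bounded L K'"
  by (auto simp: bounded_iff_controlled elim!: controlled_mono)

lemma bounded_Image:
  assumes K: "ls_bounded L K" and E: "controlled L E"
  shows "ls_bounded L (K \<union> E `` K)"
proof -
  \<comment> \<open>With the diagonal added, both \<open>K\<close> and its image under
    \<open>E\<close> are reached from \<open>K\<close>, so two points of the union are joined by
    going back to \<open>K\<close>, across \<open>K\<close>, and out again.\<close>
  let ?E = "E \<union> Id_on X"
  have E': "controlled L ?E"
    by (intro controlled_Un controlled_Id E)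
  have "K \<subseteq> X"
    using K controlled_subset_X by (auto simp: bounded_iff_controlled)
  then have "(K \<union> E `` K) \<times> (K \<union> E `` K) \<subseteq> ?E\<inverse> O (K \<times> K) O ?E"
    by blast
  moreover have "controlled L (?E\<inverse> O (K \<times> K) O ?E)"
    using K[unfolded bounded_iff_controlled] E' by (intro controlled_relcomp controlled_converse)
  ultimately show ?thesis
    by (auto simp: bounded_iff_controlled elim: controlled_mono)
qed

section \<open>Close maps, continuous maps and coarse equivalences in terms of controlled
  sets\<close>

lemma close_iff_controlled: "ls_close X L f g \<longleftrightarrow> controlled L ((\<lambda>x. (f x, g x)) ` X)"
  by (simp add: ls_close_def controlled_def image_image)

lemma close_refl: "f \<in> X \<rightarrow> X \<Longrightarrow> ls_close X L f f"
  unfolding close_iff_controlled by (rule controlled_mono[OF controlled_Id]) auto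

lemma close_sym: "ls_close X L f g \<Longrightarrow> ls_close X L g f"
  by (simp add: ls_close_def insert_commute)

lemma close_trans:
  assumes "ls_close X L f g" "ls_close X L g h"
  shows "ls_close X L f h"
  unfolding close_iff_controlled
  by (rule controlled_mono[OF controlled_relcomp[OF assms[unfolded close_iff_controlled]]]) auto

lemma continuous_iff_controlled:
  "ls_continuous X L X L f \<longleftrightarrow>
    f \<in> X \<rightarrow> X \<and> (\<forall>E. controlled L E \<longrightarrow> controlled L (map_prod f f ` E))"
proof -
  let ?p = "\<lambda>(x, y). {x, y}"
  have pairs: "(\<lambda>U. f ` U) ` ?p ` E = ?p ` map_prod f f ` E" for E
    unfolding image_image by (rule image_cong) auto
  have "(\<forall>\<U>\<in>L. (\<lambda>U. f ` U) ` \<U> \<in> L) \<longleftrightarrow> (\<forall>E. controlled L E \<longrightarrow> controlled L (map_prod f f ` E))"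
    (is "?l \<longleftrightarrow> ?r")
  proof
    assume ?l
    then show ?r
      unfolding controlled_def pairs[symmetric] by simp
  next
    assume r: ?r
    show ?l
    proof
      fix \<U> assume "\<U> \<in> L"
      then have "controlled L (map_prod f f ` (\<Union>U\<in>\<U>. U \<times> U))"
        using r in_iff_controlled by simp
      also have "map_prod f f ` (\<Union>U\<in>\<U>. U \<times> U) = (\<Union>B\<in>(\<lambda>U. f ` U) ` \<U>. B \<times> B)"
        by (simp add: image_UN map_prod_image_Times)
      finally show "(\<lambda>U. f ` U) ` \<U> \<in> L"
        by (simp only: in_iff_controlled)
    qed
  qed
  then show ?thesis
    by (simp add: ls_continuous_def)
qed

lemma coarse_equivalence_iff_controlled:
  "coarse_equivalence X L X L f \<longleftrightarrow>
    ls_continuous X L X L f \<and>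
    (\<exists>E. controlled L E \<and> (\<forall>y\<in>X. \<exists>x\<in>X. (f x, y) \<in> E)) \<and>
    (\<forall>E. controlled L E \<longrightarrow> controlled L {(x, y). x \<in> X \<and> y \<in> X \<and> (f x, f y) \<in> E})"
proof -
  let ?p = "\<lambda>(x, y). {x, y}"
  have "(\<exists>\<V>\<in>L. X \<subseteq> star (f ` X) \<V>) \<longleftrightarrow>
    (\<exists>E. controlled L E \<and> (\<forall>y\<in>X. \<exists>x\<in>X. (f x, y) \<in> E))" (is "?l \<longleftrightarrow> ?r")
  proof
    assume ?l
    then obtain \<V> where V: "\<V> \<in> L" "X \<subseteq> star (f ` X) \<V>" by blast
    then have "\<forall>y\<in>X. \<exists>x\<in>X. (f x, y) \<in> (\<Union>V\<in>\<V>. V \<times> V)"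
      by (fastforce simp: star_def)
    then show ?r
      using V(1)[unfolded in_iff_controlled] by blast
  next
    assume ?r
    then obtain E where E: "controlled L E" "\<forall>y\<in>X. \<exists>x\<in>X. (f x, y) \<in> E" by blast
    have "X \<subseteq> star (f ` X) (?p ` E)"
    proof
      fix y assume "y \<in> X"
      then obtain x where "x \<in> X" "(f x, y) \<in> E" using E by blast
      then have "{f x, y} \<in> ?p ` E" "f x \<in> f ` X"
        by (auto simp: image_iff)
      then show "y \<in> star (f ` X) (?p ` E)"
        by (rule in_starI) auto
    qed
    then show ?l
      using E(1) by (auto simp: controlled_def)
  qed
  moreover have "(\<forall>\<V>\<in>L. (\<lambda>V. f -` V \<inter> X) ` \<V> \<in> L) \<longleftrightarrow>
    (\<forall>E. controlled L E \<longrightarrow> controlled L {(x, y). x \<in> X \<and> y \<in> X \<and> (f x, f y) \<in> E})"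
    (is "?l \<longleftrightarrow> ?r")
  proof
    assume l: ?l
    show ?r
    proof (intro allI impI)
      fix E assume "controlled L E"
      then have "(\<lambda>V. f -` V \<inter> X) ` ?p ` E \<in> L"
        using l by (simp add: controlled_def)
      then have "controlled L (\<Union>B\<in>(\<lambda>V. f -` V \<inter> X) ` ?p ` E. B \<times> B)"
        by (simp only: in_iff_controlled)
      then show "controlled L {(x, y). x \<in> X \<and> y \<in> X \<and> (f x, f y) \<in> E}"
      proof (rule controlled_mono, safe)
        fix x y assume xy: "x \<in> X" "y \<in> X" "(f x, f y) \<in> E"
        then have "{f x, f y} \<in> ?p ` E"
          by (auto simp: image_iff)
        moreover have "(x, y) \<in> (f -` {f x, f y} \<inter> X) \<times> (f -` {f x, f y} \<inter> X)"
          using xy by simp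
        ultimately show "(x, y) \<in> (\<Union>B\<in>(\<lambda>V. f -` V \<inter> X) ` ?p ` E. B \<times> B)"
          by (rule UN_I[OF imageI])
      qed
    qed
  next
    assume r: ?r
    show ?l
    proof
      fix \<V> assume "\<V> \<in> L"
      then have "controlled L {(x, y). x \<in> X \<and> y \<in> X \<and> (f x, f y) \<in> (\<Union>V\<in>\<V>. V \<times> V)}"
        using r in_iff_controlled by blast
      then have "controlled L (\<Union>B\<in>(\<lambda>V. f -` V \<inter> X) ` \<V>. B \<times> B)"
        by (rule controlled_mono) auto
      then show "(\<lambda>V. f -` V \<inter> X) ` \<V> \<in> L"
        by (simp only: in_iff_controlled)
    qed
  qed
  ultimately show ?thesis
    unfolding coarse_equivalence_def by blast
qed

lemma bounded_image:
  assumes "ls_continuous X L X L f" "ls_bounded L K"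
  shows "ls_bounded L (f ` K)"
  using assms by (simp add: continuous_iff_controlled bounded_iff_controlled
      flip: map_prod_image_Times)

text \<open>The triangle passes through \<open>f' (h x)\<close>: the first side is closeness of
  \<open>f\<close> and \<open>f'\<close> at the point \<open>h x\<close>, the second is the image
  under \<open>f'\<close> of closeness of \<open>h\<close> and \<open>h'\<close>.\<close>

lemma close_comp_continuous:
  assumes "ls_close X L f f'" "ls_close X L h h'" "ls_continuous X L X L f'"
    "h \<in> X \<rightarrow> X"
  shows "ls_close X L (compose X f h) (compose X f' h')"
proof -
  have "controlled L ((\<lambda>x. (f x, f' x)) ` X O map_prod f' f' ` (\<lambda>x. (h x, h' x)) ` X)"
    using assms by (intro controlled_relcomp) (simp_all add: close_iff_controlled continuous_iff_controlled)
  then show ?thesis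
    unfolding close_iff_controlled
  proof (rule controlled_mono, safe)
    fix x assume x: "x \<in> X"
    then have "h x \<in> X" using assms(4) by blast
    then have "(f (h x), f' (h x)) \<in> (\<lambda>x. (f x, f' x)) ` X" by (rule imageI)
    moreover have "(f' (h x), f' (h' x)) \<in> map_prod f' f' ` (\<lambda>x. (h x, h' x)) ` X"
      using x by (intro map_prod_imageI imageI)
    ultimately show "(compose X f h x, compose X f' h' x)
        \<in> (\<lambda>x. (f x, f' x)) ` X O map_prod f' f' ` (\<lambda>x. (h x, h' x)) ` X"
      using x by (auto simp: compose_eq)
  qed
qed

lemma continuous_compose:
  assumes "ls_continuous X L X L f" "ls_continuous X L X L h"
  shows "ls_continuous X L X L (compose X f h)"
  unfolding continuous_iff_controlled
proof (intro conjI allI impI)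
  show "compose X f h \<in> X \<rightarrow> X"
    using assms by (auto simp: continuous_iff_controlled compose_def)
  fix E assume E: "controlled L E"
  have "map_prod (compose X f h) (compose X f h) ` E = map_prod f f ` map_prod h h ` E"
    unfolding image_image using controlled_subset_X[OF E]
    by (intro image_cong) (auto simp: compose_eq)
  then show "controlled L (map_prod (compose X f h) (compose X f h) ` E)"
    using assms E by (simp add: continuous_iff_controlled)
qed

lemma coarse_equivalence_compose:
  assumes f: "coarse_equivalence X L X L f" and h: "coarse_equivalence X L X L h"
  shows "coarse_equivalence X L X L (compose X f h)"
  unfolding coarse_equivalence_iff_controlled
proof (intro conjI allI impI)
  have cont: "ls_continuous X L X L f" "ls_continuous X L X L h"
    using f h by (auto simp: coarse_equivalence_def)
  then show "ls_continuous X L X L (compose X f h)"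
    by (rule continuous_compose)
  have hX: "h \<in> X \<rightarrow> X"
    using cont by (simp add: continuous_iff_controlled)
  obtain D where D: "controlled L D" "\<And>y. y \<in> X \<Longrightarrow> \<exists>x\<in>X. (f x, y) \<in> D"
    using f unfolding coarse_equivalence_iff_controlled by blast
  obtain E where E: "controlled L E" "\<And>y. y \<in> X \<Longrightarrow> \<exists>x\<in>X. (h x, y) \<in> E"
    using h unfolding coarse_equivalence_iff_controlled by blast
  show "\<exists>E. controlled L E \<and> (\<forall>y\<in>X. \<exists>x\<in>X. (compose X f h x, y) \<in> E)"
  proof (intro exI conjI ballI)
    show "controlled L (map_prod f f ` E O D)"
      \<comment> \<open>A point \<open>y\<close> is near some \<open>f x\<close>, and
        \<open>x\<close> is near some \<open>h z\<close>; pushing the second pair forward by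
        \<open>f\<close> puts \<open>f (h z)\<close> near \<open>f x\<close>, hence near
        \<open>y\<close>.\<close>
      using cont D(1) E(1) by (simp add: continuous_iff_controlled controlled_relcomp)
    fix y assume "y \<in> X"
    then obtain x where x: "x \<in> X" "(f x, y) \<in> D" using D by blast
    obtain z where z: "z \<in> X" "(h z, x) \<in> E" using E x by blast
    have "(f (h z), f x) \<in> map_prod f f ` E"
      using z by (force simp: image_iff)
    then show "\<exists>x\<in>X. (compose X f h x, y) \<in> map_prod f f ` E O D"
      using x z by (auto simp: compose_def)
  qed
  fix E assume "controlled L E"
  then have "controlled L {(x, y). x \<in> X \<and> y \<in> X \<and> (f x, f y) \<in> E}"
    using f by (simp add: coarse_equivalence_iff_controlled)
  then have "controlled L {(x, y). x \<in> X \<and> y \<in> X \<and>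
      (h x, h y) \<in> {(x, y). x \<in> X \<and> y \<in> X \<and> (f x, f y) \<in> E}}"
    using h unfolding coarse_equivalence_iff_controlled by blast
  then show "controlled L {(x, y). x \<in> X \<and> y \<in> X \<and> (compose X f h x, compose X f h y) \<in> E}"
    by (rule controlled_mono) (use hX in \<open>auto simp: compose_def\<close>)
qed

end

section \<open>Structures given by entourages, and generated structures\<close>

text \<open>A way to exhibit upper bounds for generated structures. Symmetry is built in, since the
  union of the squares \<open>B \<times> B\<close> is always symmetric.\<close>

lemma large_scale_space_of_entourages:
  assumes empty: "Q {}"
    and mono: "\<And>E D. Q E \<Longrightarrow> D \<subseteq> E \<Longrightarrow> Q D"
    and Id: "\<And>E. Q E \<Longrightarrow> Q (E \<union> Id_on X)"
    and comp: "\<And>E D. Q E \<Longrightarrow> Q D \<Longrightarrow> Q (E O D)"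
  shows "large_scale_space X {\<B>. \<B> \<subseteq> Pow X \<and> Q (\<Union>B\<in>\<B>. B \<times> B)}" (is "large_scale_space X ?M")
proof
  show "?M \<subseteq> Pow (Pow X)" by auto
  have "{} \<in> ?M" using empty by simp
  then show "?M \<noteq> {}" by blast
next
  fix \<B> \<C>
  assume B: "\<B> \<in> ?M" and C: "\<C> \<subseteq> Pow X"
    and ref: "\<And>B. B \<in> \<C> \<Longrightarrow> \<exists>x\<in>B. \<exists>y\<in>B. x \<noteq> y \<Longrightarrow> \<exists>B'\<in>\<B>. B \<subseteq> B'"
  \<comment> \<open>Members of \<open>\<C>\<close> with a single point need not refine anything, but
    they contribute only diagonal pairs.\<close>
  have "(\<Union>B\<in>\<C>. B \<times> B) \<subseteq> (\<Union>B\<in>\<B>. B \<times> B) \<union> Id_on X"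
  proof (rule UN_least, rule subrelI)
    fix B x y assume xy: "B \<in> \<C>" "(x, y) \<in> B \<times> B"
    show "(x, y) \<in> (\<Union>B\<in>\<B>. B \<times> B) \<union> Id_on X"
    proof (cases "x = y")
      case True
      have "x \<in> X"
        using xy C by blast
      then show ?thesis
        unfolding True by (intro UnI2 Id_onI)
    next
      case False
      then have "\<exists>x\<in>B. \<exists>y\<in>B. x \<noteq> y"
        using xy by blast
      then obtain B' where "B' \<in> \<B>" "B \<subseteq> B'"
        using ref[OF xy(1)] by blast
      then show ?thesis
        using xy by (intro UnI1 UN_I[of B']) auto
    qed
  qed
  moreover have "Q ((\<Union>B\<in>\<B>. B \<times> B) \<union> Id_on X)"
    using B by (intro Id) simp
  ultimately show "\<C> \<in> ?M"
    using C mono by simp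
next
  fix \<B> \<C>
  assume B: "\<B> \<in> ?M" and C: "\<C> \<in> ?M"
  let ?B = "\<Union>B\<in>\<B>. B \<times> B" and ?C = "\<Union>B\<in>\<C>. B \<times> B"
  \<comment> \<open>Each of two points of a star of \<open>B\<close> shares a member of
    \<open>\<C>\<close> with a point of \<open>B\<close>, which gives a path of three steps.\<close>
  have "(\<Union>B\<in>star_family \<B> \<C>. B \<times> B) \<subseteq> ?C O ?B O ?C"
  proof (rule UN_least, rule subrelI)
    fix S x y assume "S \<in> star_family \<B> \<C>" and xy: "(x, y) \<in> S \<times> S"
    then obtain B where B: "B \<in> \<B>" "S = star B \<C>"
      by (auto simp: star_family_def)
    obtain C1 b1 where 1: "C1 \<in> \<C>" "x \<in> C1" "b1 \<in> C1" "b1 \<in> B"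
      using xy B by (auto simp: star_def)
    obtain C2 b2 where 2: "C2 \<in> \<C>" "y \<in> C2" "b2 \<in> C2" "b2 \<in> B"
      using xy B by (auto simp: star_def)
    have "(x, b1) \<in> ?C" "(b1, b2) \<in> ?B" "(b2, y) \<in> ?C"
      using 1 2 B by blast+
    then show "(x, y) \<in> ?C O ?B O ?C"
      by (intro relcompI)
  qed
  moreover have "Q (?C O ?B O ?C)"
    using B C comp by auto
  moreover have "star_family \<B> \<C> \<subseteq> Pow X"
    using C by (auto simp: star_family_def star_def)
  ultimately show "star_family \<B> \<C> \<in> ?M"
    using mono by simp
qed

lemma generated_ls_superset: "\<C> \<subseteq> generated_ls X \<C>"
  by (auto simp: generated_ls_def)

lemma generated_ls_least: "large_scale_space X M \<Longrightarrow> \<C> \<subseteq> M \<Longrightarrow> generated_ls X \<C> \<subseteq> M"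
  by (auto simp: generated_ls_def)

text \<open>The axioms pass to intersections. The structure \<open>Pow (Pow X)\<close> takes part in
  the intersection and keeps it among families of subsets of \<open>X\<close>; the empty family lies
  in every structure and makes the intersection nonempty.\<close>

lemma large_scale_space_generated_ls:
  assumes "\<C> \<subseteq> Pow (Pow X)"
  shows "large_scale_space X (generated_ls X \<C>)"
proof -
  have "{\<B>. \<B> \<subseteq> Pow X \<and> True} = Pow (Pow X)" by auto
  then have top: "large_scale_space X (Pow (Pow X))"
    using large_scale_space_of_entourages[of "\<lambda>_. True" X] by simp
  show ?thesis
  proof
    show "generated_ls X \<C> \<subseteq> Pow (Pow X)"
      by (rule generated_ls_least[OF top assms])
    have "{} \<in> L" if "large_scale_space X L" for L :: "'a set set set"
    proof -
      interpret large_scale_space X L by fact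
      show ?thesis using controlled_empty by (simp add: controlled_def)
    qed
    then show "generated_ls X \<C> \<noteq> {}"
      by (auto simp: generated_ls_def)
  next
    fix \<B> \<D>
    assume "\<B> \<in> generated_ls X \<C>" "\<D> \<subseteq> Pow X"
      "\<And>B. B \<in> \<D> \<Longrightarrow> \<exists>x\<in>B. \<exists>y\<in>B. x \<noteq> y \<Longrightarrow> \<exists>B'\<in>\<B>. B \<subseteq> B'"
    then show "\<D> \<in> generated_ls X \<C>"
      unfolding generated_ls_def
      by (intro InterI, elim CollectE conjE, intro large_scale_space.refine[of X _ \<B> \<D>]) auto
  next
    fix \<B> \<D>
    assume "\<B> \<in> generated_ls X \<C>" "\<D> \<in> generated_ls X \<C>"
    then show "star_family \<B> \<D> \<in> generated_ls X \<C>"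
      unfolding generated_ls_def
      by (intro InterI, elim CollectE conjE, intro large_scale_space.star_closed[of X]) auto
  qed
qed

text \<open>The form in which one-endedness is used: a property shared by all points of
  \<open>A\<close> in a common member of the cover spreads along chains.\<close>

lemma cover_connected_propagate:
  assumes conn: "cover_connected \<U> A" and A: "A \<subseteq> \<Union>\<U>" and x: "x \<in> A" "P x" and y: "y \<in> A"
    and step: "\<And>U u v. U \<in> \<U> \<Longrightarrow> u \<in> U \<inter> A \<Longrightarrow> v \<in> U \<inter> A \<Longrightarrow> P u \<Longrightarrow> P v"
  shows "P y"
proof -
  let ?V = "(\<lambda>U. U \<inter> A) ` \<U>"
  \<comment> \<open>Since the cover reaches \<open>y\<close>, the chain of length zero puts
    \<open>y\<close> into its own component, which equals the component of \<open>x\<close>.\<close>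
  obtain U0 where "U0 \<in> ?V" "y \<in> U0"
    using y A by blast
  then have "y \<in> cover_component ?V y"
    unfolding cover_component_def by (auto intro!: exI[of _ "0::nat"] exI[of _ "\<lambda>_. U0"])
  then have "y \<in> cover_component ?V x"
    using conn x(1) y unfolding cover_connected_def by blast
  then obtain n :: nat and U where U: "\<And>i. i \<le> n \<Longrightarrow> U i \<in> ?V" "x \<in> U 0" "y \<in> U n"
    "\<And>i. i < n \<Longrightarrow> U i \<inter> U (Suc i) \<noteq> {}"
    unfolding cover_component_def by blast
  have all: "\<forall>v\<in>U i. P v" if "i \<le> n" "u \<in> U i" "P u" for i u
    using U(1)[OF that(1)] step that(2,3) by blast
  have "\<forall>v\<in>U i. P v" if "i \<le> n" for i
    using that
  proof (induction i)
    case 0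
    then show ?case using all[of 0 x] U(2) x(2) by simp
  next
    case (Suc i)
    then have "U i \<inter> U (Suc i) \<noteq> {}"
      by (intro U(4)) simp
    then obtain u where "u \<in> U i" "u \<in> U (Suc i)"
      by blast
    moreover have "P u"
      using Suc.IH Suc.prems calculation(1) by simp
    ultimately show ?case
      using all[OF Suc.prems] by blast
  qed
  then show ?thesis using U(3) by blast
qed

section \<open>Unions of bounded sets, and points at infinite distance\<close>

context large_scale_space
begin

text \<open>Two bounded sets may be infinitely far apart; a single controlled pair
  \<open>(a, b)\<close> bridges them, and every cross pair goes through it.\<close>

lemma bounded_Un:
  assumes conn: "\<And>x y. x \<in> X \<Longrightarrow> y \<in> X \<Longrightarrow> controlled L {(x, y)}"
    and K: "ls_bounded L K" "ls_bounded L K'"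
  shows "ls_bounded L (K \<union> K')"
proof (cases "K = {} \<or> K' = {}")
  case True
  then show ?thesis using K by auto
next
  case False
  then obtain a b where ab: "a \<in> K" "b \<in> K'" by auto
  have KK: "controlled L (K \<times> K)" "controlled L (K' \<times> K')"
    using K by (simp_all add: bounded_iff_controlled)
  then have "a \<in> X" "b \<in> X"
    using ab controlled_subset_X by blast+
  then have C: "controlled L ((K \<times> K) O {(a, b)} O (K' \<times> K'))" (is "controlled L ?C")
    using KK by (intro controlled_relcomp conn)
  have "controlled L (K \<times> K \<union> K' \<times> K' \<union> ?C \<union> ?C\<inverse>)"
    by (intro controlled_Un controlled_converse KK C)
  then show ?thesis
    unfolding bounded_iff_controlled by (rule controlled_mono) (use ab in blast)
qed

lemma bounded_UN:
  assumes conn: "\<And>x y. x \<in> X \<Longrightarrow> y \<in> X \<Longrightarrow> controlled L {(x, y)}"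
    and "finite I" "\<And>i. i \<in> I \<Longrightarrow> ls_bounded L (K i)"
  shows "ls_bounded L (\<Union>i\<in>I. K i)"
  using assms(2,3)
proof (induction I rule: finite_induct)
  case empty
  then show ?case by (simp add: bounded_iff_controlled controlled_empty)
next
  case (insert i I)
  then show ?case using bounded_Un[OF conn] by simp
qed

text \<open>Being at finite distance. The classes of this relation are the coarse components of
  \<open>X\<close>.\<close>

definition connected_pts :: "'a \<Rightarrow> 'a \<Rightarrow> bool" where
  "connected_pts x y \<longleftrightarrow> controlled L {(x, y)}"

lemma connected_pts_sym: "connected_pts x y \<Longrightarrow> connected_pts y x"
  unfolding connected_pts_def by (drule controlled_converse, erule controlled_mono) simp

lemma connected_pts_trans: "connected_pts x y \<Longrightarrow> connected_pts y z \<Longrightarrow> connected_pts x z"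
  unfolding connected_pts_def
  by (drule (1) controlled_relcomp, erule controlled_mono) auto

text \<open>Continuity preserves finite distance, and controlled preimages reflect it, so
  \<open>f\<close> is injective on coarse components.\<close>

lemma connected_pts_coarse:
  assumes f: "coarse_equivalence X L X L f" and "x \<in> X" "y \<in> X"
  shows "connected_pts (f x) (f y) \<longleftrightarrow> connected_pts x y"
proof
  assume "connected_pts x y"
  then show "connected_pts (f x) (f y)"
    using f by (force simp: connected_pts_def coarse_equivalence_def continuous_iff_controlled)
next
  assume "connected_pts (f x) (f y)"
  then have "controlled L {(u, v). u \<in> X \<and> v \<in> X \<and> (f u, f v) \<in> {(f x, f y)}}"
    using f unfolding connected_pts_def coarse_equivalence_iff_controlled by blast
  then show "connected_pts x y"
    unfolding connected_pts_def by (rule controlled_mono) (use assms in auto)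
qed

text \<open>Remove from \<open>X\<close> a bounded set \<open>K\<close> around \<open>x\<close>
  whose complement is connected. What remains lies in one coarse component, so if there is a second
  component, that of \<open>x\<close> must be contained in \<open>K\<close>. Hence there are exactly
  two components, both bounded, and finite distance itself is a controlled relation.\<close>

lemma two_components:
  assumes oe: "coarsely_one_ended X L"
    and x0: "x0 \<in> X" and y0: "y0 \<in> X" and disconn: "\<not> controlled L {(x0, y0)}"
  shows "\<And>x y z. x \<in> X \<Longrightarrow> y \<in> X \<Longrightarrow> z \<in> X \<Longrightarrow>
      \<not> connected_pts x y \<Longrightarrow> \<not> connected_pts x z \<Longrightarrow> connected_pts y z"
    and "controlled L {(x, y). connected_pts x y}"
proof -
  obtain \<U> where U: "\<U> \<in> L" "\<Union>\<U> = X"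
    and ends: "\<And>K. ls_bounded L K \<Longrightarrow>
      \<exists>K'. ls_bounded L K' \<and> K \<subseteq> K' \<and> cover_connected \<U> (X - K')"
    using oe unfolding coarsely_one_ended_def by blast
  have refl: "connected_pts x x" if "x \<in> X" for x
    unfolding connected_pts_def using that by (intro controlled_mono[OF controlled_Id]) auto
  have pts: "x \<in> X \<and> y \<in> X" if "connected_pts x y" for x y
    using that controlled_subset_X[of "{(x, y)}"] by (simp add: connected_pts_def)
  have comp: "ls_bounded L {y. connected_pts x y} \<and>
      (\<forall>y\<in>X. \<forall>z\<in>X. \<not> connected_pts x y \<longrightarrow> \<not> connected_pts x z \<longrightarrow> connected_pts y z)"
    if x: "x \<in> X" for x
  proof -
    have "ls_bounded L {x}"
      using refl[OF x] by (simp add: bounded_iff_controlled connected_pts_def)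
    then obtain K where K: "ls_bounded L K" "x \<in> K" "cover_connected \<U> (X - K)"
      using ends[of "{x}"] by blast
    have Kc: "connected_pts x y" if "y \<in> K" for y
      unfolding connected_pts_def
      by (rule controlled_mono[OF K(1)[unfolded bounded_iff_controlled]]) (use K(2) that in simp)
    have outside: "connected_pts y z" if yz: "y \<in> X - K" "z \<in> X - K" for y z
    proof (rule cover_connected_propagate[where P = "connected_pts y", OF K(3) _ yz(1) _ yz(2)])
      show "X - K \<subseteq> \<Union>\<U>"
        using U(2) by blast
      show "connected_pts y y"
        using refl yz by blast
      fix U u v
      assume "U \<in> \<U>" "u \<in> U \<inter> (X - K)" "v \<in> U \<inter> (X - K)" and yu: "connected_pts y u"
      then have "connected_pts u v"
        unfolding connected_pts_def
        by (intro controlled_mono[OF U(1)[unfolded in_iff_controlled]]) auto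
      then show "connected_pts y v"
        using yu connected_pts_trans by blast
    qed
    \<comment> \<open>Since \<open>x0\<close> and \<open>y0\<close> lie in different components, at
      least one of them is not connected to \<open>x\<close>.\<close>
    obtain w where w: "w \<in> X" "\<not> connected_pts x w"
      using x0 y0 disconn connected_pts_sym connected_pts_trans
      unfolding connected_pts_def[of x0 y0, symmetric] by metis
    \<comment> \<open>The set \<open>K\<close> lies in the component of \<open>x\<close>, so
      \<open>w\<close> is outside \<open>K\<close>; a point of that component outside
      \<open>K\<close> would be joined to \<open>w\<close>.\<close>
    have "{y. connected_pts x y} \<subseteq> K"
    proof (rule subsetI, rule ccontr)
      fix y assume y: "y \<in> {y. connected_pts x y}" "y \<notin> K"
      then have "connected_pts y w"
        using pts w Kc by (intro outside) auto
      then show False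
        using y w connected_pts_trans by blast
    qed
    then show ?thesis
      using K Kc outside by (blast intro: bounded_mono)
  qed
  then show "connected_pts y z"
    if "x \<in> X" "y \<in> X" "z \<in> X" "\<not> connected_pts x y" "\<not> connected_pts x z" for x y z
    using that by blast
  let ?C = "\<lambda>x. {y. connected_pts x y}"
  have "controlled L (?C x0 \<times> ?C x0 \<union> ?C y0 \<times> ?C y0)"
    using comp[OF x0] comp[OF y0] by (intro controlled_Un) (simp_all add: bounded_iff_controlled)
  then show "controlled L {(x, y). connected_pts x y}"
  proof (rule controlled_mono, intro subrelI)
    fix x y assume "(x, y) \<in> {(x, y). connected_pts x y}"
    then have xy: "connected_pts x y" by simp
    \<comment> \<open>A point connected to neither \<open>x0\<close> nor \<open>y0\<close> would be
      a third component.\<close>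
    have "connected_pts x0 x \<or> connected_pts y0 x"
      using comp[OF x0] disconn y0 pts[OF xy] by (auto simp: connected_pts_def)
    then show "(x, y) \<in> ?C x0 \<times> ?C x0 \<union> ?C y0 \<times> ?C y0"
      using connected_pts_trans[OF _ xy] xy by blast
  qed
qed

end

section \<open>Coarse actions\<close>

locale coarse_action = large_scale_space X L + group_action G X \<phi>
  for X :: "'a set" and L and G :: "('g, 'm) monoid_scheme" (structure) and \<phi> +
  assumes continuous: "g \<in> carrier G \<Longrightarrow> ls_continuous X L X L (\<phi> g)"
begin

lemma group_G: "group G"
  using group_hom by (simp add: group_hom_def)

sublocale group G
  by (rule group_G)

lemma act_closed: "g \<in> carrier G \<Longrightarrow> x \<in> X \<Longrightarrow> \<phi> g x \<in> X"
  by (rule element_image) auto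

lemma act_one: "x \<in> X \<Longrightarrow> \<phi> \<one> x = x"
  using id_eq_one by (metis restrict_apply')

lemma act_mult: "g \<in> carrier G \<Longrightarrow> h \<in> carrier G \<Longrightarrow> x \<in> X \<Longrightarrow> \<phi> (g \<otimes> h) x = \<phi> g (\<phi> h x)"
  using composition_rule by simp

lemma act_inv: "g \<in> carrier G \<Longrightarrow> x \<in> X \<Longrightarrow> \<phi> (inv g) (\<phi> g x) = x"
  by (simp flip: act_mult add: act_one)

lemma act_inv': "g \<in> carrier G \<Longrightarrow> x \<in> X \<Longrightarrow> \<phi> g (\<phi> (inv g) x) = x"
  by (simp flip: act_mult add: act_one)

lemma act_extensional: "g \<in> carrier G \<Longrightarrow> \<phi> g \<in> X \<rightarrow>\<^sub>E X"
  using bij_prop0[of g] act_closed unfolding Bij_def by (auto simp: PiE_def)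

lemma controlled_act: "g \<in> carrier G \<Longrightarrow> controlled L E \<Longrightarrow> controlled L (map_prod (\<phi> g) (\<phi> g) ` E)"
  using continuous by (simp add: continuous_iff_controlled)

text \<open>The inverse bijection \<open>\<phi> (inv g)\<close> is continuous too, so controlled
  preimages under \<open>\<phi> g\<close> are controlled images under it.\<close>

lemma coarse_equivalence_act:
  assumes g: "g \<in> carrier G"
  shows "coarse_equivalence X L X L (\<phi> g)"
  unfolding coarse_equivalence_iff_controlled
proof (intro conjI allI impI)
  show "ls_continuous X L X L (\<phi> g)"
    using g by (rule continuous)
  have "\<forall>y\<in>X. \<exists>x\<in>X. (\<phi> g x, y) \<in> Id_on X"
    using g act_inv' act_closed by (metis Id_onI inv_closed)
  then show "\<exists>E. controlled L E \<and> (\<forall>y\<in>X. \<exists>x\<in>X. (\<phi> g x, y) \<in> E)"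
    using controlled_Id by blast
  fix E assume "controlled L E"
  then have "controlled L (map_prod (\<phi> (inv g)) (\<phi> (inv g)) ` E)"
    using g by (simp add: controlled_act)
  then show "controlled L {(x, y). x \<in> X \<and> y \<in> X \<and> (\<phi> g x, \<phi> g y) \<in> E}"
    by (rule controlled_mono) (use g in \<open>force simp: image_iff act_inv\<close>)
qed

section \<open>Controlled sets of the space \<open>X\<close> with the structure
  \<open>LG\<close>\<close>

abbreviation "LG \<equiv> quotient_ls G X L \<phi>"

text \<open>An explicit upper bound for the entourages of \<open>LG\<close>: first a move by one of
  finitely many group elements, then one step in \<open>E\<close>. Alternating sequences of moves
  and steps can be sorted into this form because the action is continuous.\<close>

definition quotient_entourage :: "('a \<times> 'a) set \<Rightarrow> bool" where
  "quotient_entourage D \<longleftrightarrow> D \<subseteq> X \<times> X \<and>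
    (\<exists>F E. finite F \<and> F \<subseteq> carrier G \<and> controlled L E \<and>
      (\<forall>x y. (x, y) \<in> D \<longrightarrow> (\<exists>g\<in>F. (\<phi> g x, y) \<in> E)))"

lemma quotient_entourageI:
  assumes "D \<subseteq> X \<times> X" "finite F" "F \<subseteq> carrier G" "controlled L E"
    "\<And>x y. (x, y) \<in> D \<Longrightarrow> \<exists>g\<in>F. (\<phi> g x, y) \<in> E"
  shows "quotient_entourage D"
  unfolding quotient_entourage_def
  by (intro conjI exI[of _ F] exI[of _ E] allI impI assms)

lemma quotient_entourageE:
  assumes "quotient_entourage D"
  obtains F E where "D \<subseteq> X \<times> X" "finite F" "F \<subseteq> carrier G" "controlled L E"
    "\<And>x y. (x, y) \<in> D \<Longrightarrow> \<exists>g\<in>F. (\<phi> g x, y) \<in> E"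
  using assms unfolding quotient_entourage_def by (elim conjE exE, intro that) (assumption | (drule spec)+, erule (1) mp)+

text \<open>If \<open>\<phi> g x\<close> is near \<open>y\<close> and \<open>\<phi> h y\<close> is
  near \<open>z\<close>, applying \<open>\<phi> h\<close> to the first pair puts
  \<open>\<phi> (h \<otimes> g) x\<close> near \<open>\<phi> h y\<close>, hence near
  \<open>z\<close>. Finiteness of \<open>F'\<close> keeps the union of the image entourages
  controlled.\<close>

lemma quotient_entourage_relcomp:
  assumes "quotient_entourage D" "quotient_entourage D'"
  shows "quotient_entourage (D O D')"
proof -
  obtain F E where D: "D \<subseteq> X \<times> X" "finite F" "F \<subseteq> carrier G" "controlled L E"
    "\<And>x y. (x, y) \<in> D \<Longrightarrow> \<exists>g\<in>F. (\<phi> g x, y) \<in> E"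
    using assms(1) by (rule quotient_entourageE) (rule that)
  obtain F' E' where D': "D' \<subseteq> X \<times> X" "finite F'" "F' \<subseteq> carrier G" "controlled L E'"
    "\<And>x y. (x, y) \<in> D' \<Longrightarrow> \<exists>g\<in>F'. (\<phi> g x, y) \<in> E'"
    using assms(2) by (rule quotient_entourageE) (rule that)
  show ?thesis
  proof (rule quotient_entourageI)
    show "D O D' \<subseteq> X \<times> X"
      using D(1) D'(1) by blast
    show "finite ((\<lambda>(h, g). h \<otimes> g) ` (F' \<times> F))"
      using D(2) D'(2) by blast
    show "(\<lambda>(h, g). h \<otimes> g) ` (F' \<times> F) \<subseteq> carrier G"
      using D(3) D'(3) by auto
    show "controlled L ((\<Union>h\<in>F'. map_prod (\<phi> h) (\<phi> h) ` E) O E')"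
      using D'(2,3,4) D(4) by (intro controlled_relcomp controlled_UN controlled_act) auto
    fix x z assume "(x, z) \<in> D O D'"
    then obtain y where y: "(x, y) \<in> D" "(y, z) \<in> D'" by blast
    obtain g where g: "g \<in> F" "(\<phi> g x, y) \<in> E" using D y by blast
    obtain h where h: "h \<in> F'" "(\<phi> h y, z) \<in> E'" using D' y by blast
    have eq: "\<phi> (h \<otimes> g) x = \<phi> h (\<phi> g x)"
      using g h y D D' by (intro act_mult) auto
    have "(\<phi> (h \<otimes> g) x, \<phi> h y) \<in> map_prod (\<phi> h) (\<phi> h) ` E"
      unfolding eq using g(2) by (rule map_prod_imageI)
    then have "(\<phi> (h \<otimes> g) x, z) \<in> (\<Union>h\<in>F'. map_prod (\<phi> h) (\<phi> h) ` E) O E'"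
      using h by (intro relcompI UN_I)
    moreover have "h \<otimes> g \<in> (\<lambda>(h, g). h \<otimes> g) ` (F' \<times> F)"
      using g(1) h(1) by (intro image_eqI[of _ _ "(h, g)"]) auto
    ultimately show "\<exists>k\<in>(\<lambda>(h, g). h \<otimes> g) ` (F' \<times> F).
        (\<phi> k x, z) \<in> (\<Union>h\<in>F'. map_prod (\<phi> h) (\<phi> h) ` E) O E'"
      by (rule bexI)
  qed
qed

lemma large_scale_space_quotient_entourages:
  "large_scale_space X {\<B>. \<B> \<subseteq> Pow X \<and> quotient_entourage (\<Union>B\<in>\<B>. B \<times> B)}"
proof (rule large_scale_space_of_entourages)
  show "quotient_entourage {}"
    by (rule quotient_entourageI[of _ "{}" "{}"]) (auto simp: controlled_empty)
  show "quotient_entourage D'" if D: "quotient_entourage D" and sub: "D' \<subseteq> D" for D D'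
  proof -
    obtain F E where "D \<subseteq> X \<times> X" "finite F" "F \<subseteq> carrier G" "controlled L E"
      "\<And>x y. (x, y) \<in> D \<Longrightarrow> \<exists>g\<in>F. (\<phi> g x, y) \<in> E"
      using D by (rule quotient_entourageE) (rule that)
    then show ?thesis
      using sub by (intro quotient_entourageI[of D' F E]) auto
  qed
  show "quotient_entourage (D \<union> Id_on X)" if D: "quotient_entourage D" for D
  proof -
    obtain F E where D: "D \<subseteq> X \<times> X" "finite F" "F \<subseteq> carrier G" "controlled L E"
      "\<And>x y. (x, y) \<in> D \<Longrightarrow> \<exists>g\<in>F. (\<phi> g x, y) \<in> E"
      using D by (rule quotient_entourageE) (rule that)
    show ?thesis
    \<comment> \<open>Diagonal pairs are reached by the unit, which moves no point.\<close>
    proof (rule quotient_entourageI[of _ "insert \<one> F" "E \<union> Id_on X"])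
      show "controlled L (E \<union> Id_on X)"
        using D(4) controlled_Id by (rule controlled_Un)
      show "\<exists>g\<in>insert \<one> F. (\<phi> g x, y) \<in> E \<union> Id_on X" if "(x, y) \<in> D \<union> Id_on X" for x y
      proof (cases "(x, y) \<in> D")
        case True
        then show ?thesis using D(5)[OF True] by blast
      next
        case False
        then show ?thesis using that by (auto simp: act_one)
      qed
    qed (use D(1-3) in auto)
  qed
qed (rule quotient_entourage_relcomp)

lemma generators_subset:
  "L \<union> (\<lambda>g. (\<lambda>x. {x, \<phi> g x}) ` X) ` carrier G \<subseteq> Pow (Pow X)"
  using families act_closed by auto

lemma large_scale_space_quotient: "large_scale_space X LG"
  unfolding quotient_ls_def by (rule large_scale_space_generated_ls[OF generators_subset])

lemma L_subset_quotient: "L \<subseteq> LG"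
  unfolding quotient_ls_def by (rule order_trans[OF Un_upper1 generated_ls_superset])

lemma act_close_id:
  assumes g: "g \<in> carrier G"
  shows "ls_close X LG (\<phi> g) (\<lambda>x. x)"
proof -
  have "(\<lambda>x. {x, \<phi> g x}) ` X \<in> LG"
    unfolding quotient_ls_def by (intro subsetD[OF generated_ls_superset] UnI2 imageI g)
  then show ?thesis
    by (simp add: ls_close_def insert_commute)
qed

text \<open>By minimality of the generated structure only the generators need checking.\<close>

lemma quotient_subset:
  "LG \<subseteq> {\<B>. \<B> \<subseteq> Pow X \<and> quotient_entourage (\<Union>B\<in>\<B>. B \<times> B)}" (is "_ \<subseteq> ?M")
  unfolding quotient_ls_def
proof (rule generated_ls_least[OF large_scale_space_quotient_entourages])
  have "\<B> \<in> ?M" if B: "\<B> \<in> L" for \<B>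
  proof -
    let ?E = "\<Union>B\<in>\<B>. B \<times> B"
    have E: "controlled L ?E"
      using B in_iff_controlled by simp
    have "quotient_entourage ?E"
    proof (rule quotient_entourageI[OF controlled_subset_X[OF E] _ _ E])
      show "\<exists>g\<in>{\<one>}. (\<phi> g x, y) \<in> ?E" if xy: "(x, y) \<in> ?E" for x y
      proof -
        have "x \<in> X"
          using subsetD[OF controlled_subset_X[OF E] xy] by simp
        then show ?thesis
          using xy act_one by simp
      qed
    qed auto
    moreover have "\<B> \<subseteq> Pow X"
      using B families by blast
    ultimately show ?thesis
      by simp
  qed
  moreover have "(\<lambda>x. {x, \<phi> g x}) ` X \<in> ?M" if g: "g \<in> carrier G" for g
  proof -
    have "quotient_entourage (\<Union>B\<in>(\<lambda>x. {x, \<phi> g x}) ` X. B \<times> B)"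
    \<comment> \<open>Each pair of points of \<open>{z, \<phi> g z}\<close> is realized exactly by
      the unit, \<open>g\<close> or \<open>inv g\<close>, so the diagonal serves as the
      entourage.\<close>
    proof (rule quotient_entourageI[of _ "{\<one>, g, inv g}" "Id_on X"])
      fix x y assume "(x, y) \<in> (\<Union>B\<in>(\<lambda>x. {x, \<phi> g x}) ` X. B \<times> B)"
      then obtain z where z: "z \<in> X" "x \<in> {z, \<phi> g z}" "y \<in> {z, \<phi> g z}"
        by blast
      moreover have "\<phi> g z \<in> X"
        using g z(1) by (rule act_closed)
      ultimately show "\<exists>h\<in>{\<one>, g, inv g}. (\<phi> h x, y) \<in> Id_on X"
        using act_inv[OF g z(1)] act_one by auto
    next
      show "(\<Union>B\<in>(\<lambda>x. {x, \<phi> g x}) ` X. B \<times> B) \<subseteq> X \<times> X"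
        using act_closed[OF g] by auto
    qed (use g controlled_Id in auto)
    moreover have "(\<lambda>x. {x, \<phi> g x}) ` X \<subseteq> Pow X"
      using act_closed[OF g] by auto
    ultimately show ?thesis
      by blast
  qed
  ultimately show "L \<union> (\<lambda>g. (\<lambda>x. {x, \<phi> g x}) ` X) ` carrier G \<subseteq> ?M"
    by blast
qed

lemma close_id_quotientE:
  assumes "ls_close X LG f (\<lambda>x. x)"
  obtains F E where "finite F" "F \<subseteq> carrier G" "controlled L E"
    "\<And>x. x \<in> X \<Longrightarrow> \<exists>g\<in>F. (\<phi> g x, f x) \<in> E"
proof -
  have "quotient_entourage (\<Union>B\<in>(\<lambda>x. {f x, x}) ` X. B \<times> B)"
    using assms quotient_subset unfolding ls_close_def by blast
  then obtain F E where "finite F" "F \<subseteq> carrier G" "controlled L E"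
    "\<And>x y. (x, y) \<in> (\<Union>B\<in>(\<lambda>x. {f x, x}) ` X. B \<times> B) \<Longrightarrow> \<exists>g\<in>F. (\<phi> g x, y) \<in> E"
    by (rule quotient_entourageE) blast
  then show ?thesis
    using that[of F E] by blast
qed

section \<open>The automorphism group and the map from \<open>G\<close>\<close>

abbreviation "maps \<equiv> coarse_aut_maps X L LG"
abbreviation "cls \<equiv> coarse_aut_class X L LG"

lemma act_in_maps: "g \<in> carrier G \<Longrightarrow> \<phi> g \<in> maps"
  using act_extensional coarse_equivalence_act act_close_id by (simp add: coarse_aut_maps_def)

lemma mapsD:
  assumes "f \<in> maps"
  shows "f \<in> X \<rightarrow>\<^sub>E X" "f \<in> X \<rightarrow> X" "coarse_equivalence X L X L f" "ls_close X LG f (\<lambda>x. x)"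
  using assms by (auto simp: coarse_aut_maps_def)

lemma equiv_rel: "equiv maps (coarse_aut_rel X L LG)"
proof (rule equivI)
  show "coarse_aut_rel X L LG \<subseteq> maps \<times> maps"
    by (auto simp: coarse_aut_rel_def)
  show "refl_on maps (coarse_aut_rel X L LG)"
    using close_refl mapsD by (auto simp: refl_on_def coarse_aut_rel_def)
  show "sym (coarse_aut_rel X L LG)"
    using close_sym by (auto simp: sym_def coarse_aut_rel_def)
  show "trans (coarse_aut_rel X L LG)"
    using close_trans by (fastforce simp: trans_def coarse_aut_rel_def)
qed

lemma class_eq: "f \<in> maps \<Longrightarrow> h \<in> maps \<Longrightarrow> ls_close X L f h \<Longrightarrow> cls f = cls h"
  unfolding coarse_aut_class_def
  by (rule equiv_class_eq[OF equiv_rel]) (simp add: coarse_aut_rel_def)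

lemma class_eq_iff: "f \<in> maps \<Longrightarrow> h \<in> maps \<Longrightarrow> cls f = cls h \<longleftrightarrow> ls_close X L f h"
  using eq_equiv_class_iff[OF equiv_rel, of f h]
  by (simp add: coarse_aut_class_def coarse_aut_rel_def)

lemma compose_act: "g \<in> carrier G \<Longrightarrow> h \<in> carrier G \<Longrightarrow> compose X (\<phi> g) (\<phi> h) = \<phi> (g \<otimes> h)"
  using act_extensional[of "g \<otimes> h"]
  by (intro extensionalityI[of _ X]) (auto simp: compose_def act_mult PiE_def)

text \<open>Independence of representatives. The composite is close to the identity in
  \<open>LG\<close> because it is close in \<open>L\<close> to
  \<open>\<phi> (g \<otimes> h)\<close>, which is.\<close>

lemma compose_close:
  assumes g: "g \<in> carrier G" and h: "h \<in> carrier G"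
    and f: "f \<in> maps" "ls_close X L (\<phi> g) f" and k: "k \<in> maps" "ls_close X L (\<phi> h) k"
  shows "compose X f k \<in> maps" "ls_close X L (compose X f k) (\<phi> (g \<otimes> h))"
proof -
  interpret Q: large_scale_space X LG by (rule large_scale_space_quotient)
  have "ls_close X L (compose X f k) (compose X (\<phi> g) (\<phi> h))"
    using close_sym[OF f(2)] close_sym[OF k(2)] continuous[OF g] mapsD(2)[OF k(1)]
    by (rule close_comp_continuous)
  then show cl: "ls_close X L (compose X f k) (\<phi> (g \<otimes> h))"
    using g h by (simp add: compose_act)
  then have "ls_close X LG (compose X f k) (\<phi> (g \<otimes> h))"
    using L_subset_quotient by (auto simp: ls_close_def)
  then have "ls_close X LG (compose X f k) (\<lambda>x. x)"
    using act_close_id g h by (blast intro: Q.close_trans)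
  moreover have "coarse_equivalence X L X L (compose X f k)"
    using f k mapsD by (intro coarse_equivalence_compose) auto
  moreover have "compose X f k \<in> X \<rightarrow>\<^sub>E X"
    using mapsD(2)[OF f(1)] mapsD(2)[OF k(1)] by (auto simp: compose_def)
  ultimately show "compose X f k \<in> maps"
    by (simp add: coarse_aut_maps_def)
qed

text \<open>The product is a union over all pairs of representatives; it collapses because all
  composites have the same class.\<close>

lemma mult_class:
  assumes g: "g \<in> carrier G" and h: "h \<in> carrier G"
  shows "cls (\<phi> g) \<otimes>\<^bsub>coarse_Aut X L LG\<^esub> cls (\<phi> h) = cls (\<phi> (g \<otimes> h))"
proof -
  have "cls (compose X f k) = cls (\<phi> (g \<otimes> h))" if "f \<in> cls (\<phi> g)" "k \<in> cls (\<phi> h)" for f k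
  proof -
    have "f \<in> maps" "ls_close X L (\<phi> g) f" "k \<in> maps" "ls_close X L (\<phi> h) k"
      using that by (auto simp: coarse_aut_class_def coarse_aut_rel_def)
    then show ?thesis
      using g h compose_close act_in_maps by (intro class_eq) auto
  qed
  \<comment> \<open>The classes must be nonempty, as otherwise the union would be empty.\<close>
  moreover have "\<phi> g \<in> cls (\<phi> g)" "\<phi> h \<in> cls (\<phi> h)"
    using act_in_maps g h equiv_class_self[OF equiv_rel] by (auto simp: coarse_aut_class_def)
  ultimately show ?thesis
    unfolding coarse_Aut_def by auto
qed

text \<open>By surjectivity every class comes from \<open>G\<close>, so the group axioms are
  inherited as for any homomorphic image of a group, instead of being verified on classes of
  maps.\<close>

lemma group_coarse_Aut:
  assumes surj: "\<And>f. f \<in> maps \<Longrightarrow> \<exists>g\<in>carrier G. ls_close X L (\<phi> g) f"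
    and inj: "\<And>g h. g \<in> carrier G \<Longrightarrow> h \<in> carrier G \<Longrightarrow> ls_close X L (\<phi> g) (\<phi> h) \<Longrightarrow> g = h"
  shows "group (coarse_Aut X L LG) \<and> (\<lambda>g. cls (\<phi> g)) \<in> iso G (coarse_Aut X L LG)"
proof -
  let ?A = "coarse_Aut X L LG" and ?h = "\<lambda>g. cls (\<phi> g)"
  have carr: "carrier ?A = cls ` maps"
    by (auto simp: coarse_Aut_def quotient_def coarse_aut_class_def)
  have img: "carrier ?A = ?h ` carrier G"
  proof
    show "carrier ?A \<subseteq> ?h ` carrier G"
    proof
      fix A assume "A \<in> carrier ?A"
      then obtain f where f: "f \<in> maps" "A = cls f"
        unfolding carr by blast
      then obtain g where g: "g \<in> carrier G" "ls_close X L (\<phi> g) f"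
        using surj by blast
      then have "cls (\<phi> g) = A"
        using class_eq[OF act_in_maps] f by simp
      then show "A \<in> ?h ` carrier G"
        using g by blast
    qed
    show "?h ` carrier G \<subseteq> carrier ?A"
      unfolding carr using act_in_maps by blast
  qed
  have hom: "?h \<in> hom G ?A"
    using img mult_class by (auto simp: hom_def)
  have "\<one>\<^bsub>?A\<^esub> = ?h \<one>"
    using id_eq_one by (simp add: coarse_Aut_def)
  \<comment> \<open>The image group in the library is \<open>?A\<close> with carrier and unit
    replaced; both replacements change nothing here.\<close>
  then have "?A\<lparr>carrier := ?h ` carrier G, one := ?h \<one>\<rparr> = ?A"
    using img by simp
  then have "group ?A"
    using hom_imp_img_group[OF hom] by simp
  moreover have "inj_on ?h (carrier G)"
    using inj act_in_maps by (auto simp: inj_on_def class_eq_iff)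
  ultimately show ?thesis
    using hom img by (auto simp: iso_def bij_betw_def)
qed

section \<open>Coarse discontinuity and injectivity\<close>

text \<open>Apply discontinuity to the sets \<open>{\<phi> k y, y}\<close>. Each meets its translate
  by \<open>k\<close> in \<open>\<phi> k y\<close>, so it must meet \<open>K\<close>; then
  \<open>y\<close> lies in \<open>K\<close> or one \<open>E\<close>-step away from it.\<close>

lemma bounded_almost_fixed:
  assumes disc: "coarsely_discontinuous G L \<phi>" and k: "k \<in> carrier G" "k \<noteq> \<one>"
    and E: "controlled L E"
  shows "ls_bounded L {y \<in> X. (\<phi> k y, y) \<in> E}"
proof -
  let ?Y = "{y \<in> X. (\<phi> k y, y) \<in> E}"
  have "(\<lambda>y. {\<phi> k y, y}) ` ?Y = (\<lambda>(x, y). {x, y}) ` (\<lambda>y. (\<phi> k y, y)) ` ?Y"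
    by (simp add: image_image)
  also have "\<dots> \<in> L"
    using controlled_mono[OF E, of "(\<lambda>y. (\<phi> k y, y)) ` ?Y"] by (auto simp: controlled_def)
  finally have "\<exists>K. ls_bounded L K \<and>
      (\<forall>U\<in>(\<lambda>y. {\<phi> k y, y}) ` ?Y. U \<inter> K = {} \<longrightarrow> U \<inter> \<phi> k ` U = {})"
    by (rule disc[unfolded coarsely_discontinuous_def, THEN bspec, THEN bspec[of _ _ k]])
      (use k in simp)
  then obtain K where K: "ls_bounded L K"
    "\<forall>U\<in>(\<lambda>y. {\<phi> k y, y}) ` ?Y. U \<inter> K = {} \<longrightarrow> U \<inter> \<phi> k ` U = {}"
    by (elim exE conjE)
  have "?Y \<subseteq> K \<union> E `` K"
  proof
    fix y assume y: "y \<in> ?Y"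
    then have "{\<phi> k y, y} \<in> (\<lambda>y. {\<phi> k y, y}) ` ?Y"
      by (rule imageI)
    then have "{\<phi> k y, y} \<inter> K = {} \<longrightarrow> {\<phi> k y, y} \<inter> \<phi> k ` {\<phi> k y, y} = {}"
      by (rule K(2)[THEN bspec])
    then have "\<phi> k y \<in> K \<or> y \<in> K"
      by auto
    then show "y \<in> K \<union> E `` K"
      using y by auto
  qed
  then show ?thesis
    using bounded_Image[OF K(1) E] by (rule bounded_mono[rotated])
qed

lemma bounded_coincidence:
  assumes disc: "coarsely_discontinuous G L \<phi>"
    and gh: "g \<in> carrier G" "h \<in> carrier G" "g \<noteq> h" and E: "controlled L E"
  shows "ls_bounded L {y \<in> X. (\<phi> g y, \<phi> h y) \<in> E}"
proof -
  \<comment> \<open>Translating by \<open>inv h\<close> turns near coincidence of \<open>g\<close>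
    and \<open>h\<close> at \<open>y\<close> into \<open>y\<close> being almost fixed by
    \<open>inv h \<otimes> g\<close>.\<close>
  let ?k = "inv h \<otimes> g"
  have k: "?k \<in> carrier G" "?k \<noteq> \<one>"
    using gh by (simp, metis inv_closed inv_equality inv_inv)
  have "ls_bounded L {y \<in> X. (\<phi> ?k y, y) \<in> map_prod (\<phi> (inv h)) (\<phi> (inv h)) ` E}"
    using gh E by (intro bounded_almost_fixed[OF disc k] controlled_act) auto
  then show ?thesis
  proof (rule bounded_mono, safe)
    fix y assume "y \<in> X" "(\<phi> g y, \<phi> h y) \<in> E"
    then show "(\<phi> ?k y, y) \<in> map_prod (\<phi> (inv h)) (\<phi> (inv h)) ` E"
      using gh by (auto simp: act_mult act_inv intro!: image_eqI[where x = "(\<phi> g y, \<phi> h y)"])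
  qed
qed

text \<open>Injectivity: for distinct \<open>g\<close> and \<open>h\<close>, closeness would make
  all of \<open>X\<close> a coincidence set, hence bounded.\<close>

lemma act_close_imp_eq:
  assumes "coarsely_discontinuous G L \<phi>" "\<not> ls_bounded L X"
    "g \<in> carrier G" "h \<in> carrier G" "ls_close X L (\<phi> g) (\<phi> h)"
  shows "g = h"
proof (rule ccontr)
  assume "g \<noteq> h"
  then have "ls_bounded L {y \<in> X. (\<phi> g y, \<phi> h y) \<in> (\<lambda>x. (\<phi> g x, \<phi> h x)) ` X}"
    using assms by (intro bounded_coincidence) (auto simp: close_iff_controlled)
  moreover have "{y \<in> X. (\<phi> g y, \<phi> h y) \<in> (\<lambda>x. (\<phi> g x, \<phi> h x)) ` X} = X"
    by auto
  ultimately show False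
    using assms(2) by simp
qed

section \<open>Surjectivity\<close>

text \<open>The case of a single coarse component, where finite unions of bounded sets are
  bounded.\<close>

lemma close_act_connected:
  assumes disc: "coarsely_discontinuous G L \<phi>" and unbounded: "\<not> ls_bounded L X"
    and oe: "coarsely_one_ended X L" and conn: "\<And>x y. x \<in> X \<Longrightarrow> y \<in> X \<Longrightarrow> controlled L {(x, y)}"
    and f: "ls_continuous X L X L f" "ls_close X LG f (\<lambda>x. x)"
  shows "\<exists>g\<in>carrier G. ls_close X L (\<phi> g) f"
proof -
  obtain F E where F: "finite F" "F \<subseteq> carrier G" and E: "controlled L E"
    and FE: "\<And>x. x \<in> X \<Longrightarrow> \<exists>g\<in>F. (\<phi> g x, f x) \<in> E"
    using f(2) by (rule close_id_quotientE) blast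
  obtain \<U> where U: "\<U> \<in> L" "\<Union>\<U> = X"
    and ends: "\<And>K. ls_bounded L K \<Longrightarrow>
      \<exists>K'. ls_bounded L K' \<and> K \<subseteq> K' \<and> cover_connected \<U> (X - K')"
    using oe unfolding coarsely_one_ended_def by blast
  define EU where "EU = (\<Union>U\<in>\<U>. U \<times> U)"
  have EU: "controlled L EU"
    using U(1) in_iff_controlled by (simp add: EU_def)
  \<comment> \<open>For neighbours \<open>u\<close>, \<open>v\<close> with \<open>g\<close> working
    at \<open>u\<close> and \<open>h\<close> at \<open>v\<close>, this is the path from
    \<open>\<phi> g v\<close> via \<open>\<phi> g u\<close>, \<open>f u\<close> and
    \<open>f v\<close> to \<open>\<phi> h v\<close>.\<close>
  define D where "D g = map_prod (\<phi> g) (\<phi> g) ` EU O E O map_prod f f ` EU O E\<inverse>" for g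
  have D: "controlled L (D g)" if "g \<in> F" for g
    using that F E EU f(1) unfolding D_def
    by (intro controlled_relcomp controlled_converse controlled_act)
      (auto simp: continuous_iff_controlled)
  \<comment> \<open>All points at which two different elements of \<open>F\<close> nearly coincide
    in the sense of that path.\<close>
  define K where "K = (\<Union>(g, h)\<in>F \<times> F - Id. {y \<in> X. (\<phi> g y, \<phi> h y) \<in> D g})"
  have "ls_bounded L K"
    unfolding K_def using F D
    by (intro bounded_UN[OF conn]) (auto intro!: bounded_coincidence[OF disc])
  then obtain K' where K': "ls_bounded L K'" "K \<subseteq> K'" "cover_connected \<U> (X - K')"
    using ends by blast
  have "K' \<subseteq> X"
    using K'(1) controlled_subset_X by (auto simp: bounded_iff_controlled)
  moreover have "K' \<noteq> X"
    using unbounded K'(1) by blast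
  ultimately obtain x0 where x0: "x0 \<in> X - K'"
    by blast
  then obtain g where g: "g \<in> F" "(\<phi> g x0, f x0) \<in> E"
    using FE by blast
  then have gG: "g \<in> carrier G"
    using F by blast
  have outside: "(\<phi> g y, f y) \<in> E" if y: "y \<in> X - K'" for y
  proof (rule cover_connected_propagate[where P = "\<lambda>y. (\<phi> g y, f y) \<in> E", OF K'(3) _ x0 g(2) y])
    show "X - K' \<subseteq> \<Union>\<U>"
      using U(2) by blast
    fix U u v
    assume uv: "U \<in> \<U>" "u \<in> U \<inter> (X - K')" "v \<in> U \<inter> (X - K')" and gu: "(\<phi> g u, f u) \<in> E"
    obtain h where h: "h \<in> F" "(\<phi> h v, f v) \<in> E"
      using FE uv by blast
    have "(u, v) \<in> EU" "(v, u) \<in> EU"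
      using uv by (auto simp: EU_def)
    then have "(\<phi> g v, \<phi> g u) \<in> map_prod (\<phi> g) (\<phi> g) ` EU" "(f u, f v) \<in> map_prod f f ` EU"
      by (metis map_prod_imageI)+
    then have "(\<phi> g v, \<phi> h v) \<in> D g"
      using gu h(2) unfolding D_def by (intro relcompI converseI)
    \<comment> \<open>Otherwise \<open>v\<close> would belong to \<open>K\<close>, but it lies
      outside \<open>K'\<close>.\<close>
    then have "h = g"
      using g(1) h(1) uv K'(2) unfolding K_def by fast
    then show "(\<phi> g v, f v) \<in> E"
      using h by blast
  qed
  \<comment> \<open>On \<open>K'\<close> nothing is known about \<open>g\<close>, but both maps have
    bounded image there, so the square of the union of the images controls the remaining
    pairs.\<close>
  have "ls_bounded L (\<phi> g ` K' \<union> f ` K')" (is "ls_bounded L ?B")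
    by (intro bounded_Un[OF conn] bounded_image K' f continuous gG)
  then have "controlled L (E \<union> ?B \<times> ?B)"
    using E by (simp add: bounded_iff_controlled controlled_Un)
  then have "ls_close X L (\<phi> g) f"
    unfolding close_iff_controlled by (rule controlled_mono) (use outside in blast)
  then show ?thesis
    using gG by blast
qed

text \<open>Points of \<open>X\<close> may be infinitely far apart. One-endedness then leaves only the case of two
  bounded pieces (think of two points at infinite distance), in which a map is determined up to
  closeness by the image of a single point.\<close>

lemma close_act_disconnected:
  assumes oe: "coarsely_one_ended X L"
    and disconn: "x0 \<in> X" "y0 \<in> X" "\<not> controlled L {(x0, y0)}"
    and f: "coarse_equivalence X L X L f" "ls_close X LG f (\<lambda>x. x)"
  shows "\<exists>g\<in>carrier G. ls_close X L (\<phi> g) f"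
proof -
  obtain F E where F: "finite F" "F \<subseteq> carrier G" and E: "controlled L E"
    and FE: "\<And>x. x \<in> X \<Longrightarrow> \<exists>g\<in>F. (\<phi> g x, f x) \<in> E"
    using f(2) by (rule close_id_quotientE) blast
  obtain g where g: "g \<in> F" "(\<phi> g x0, f x0) \<in> E"
    using FE disconn(1) by blast
  then have gG: "g \<in> carrier G"
    using F by blast
  have x0: "connected_pts (\<phi> g x0) (f x0)"
    unfolding connected_pts_def using controlled_mono[OF E] g(2) by simp
  have fX: "f \<in> X \<rightarrow> X"
    using f(1) by (simp add: coarse_equivalence_def continuous_iff_controlled)
  have "connected_pts (\<phi> g y) (f y)" if y: "y \<in> X" for y
  proof (cases "connected_pts x0 y")
    case True
    then show ?thesis
      using x0 connected_pts_coarse[OF f(1)] connected_pts_coarse[OF coarse_equivalence_act[OF gG]]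
        y disconn(1) connected_pts_trans connected_pts_sym by meson
  next
    case False
    \<comment> \<open>Both maps reflect finite distance, so \<open>\<phi> g y\<close> and
      \<open>f y\<close> avoid the component of \<open>f x0\<close>; only one other component
      remains.\<close>
    then have "\<not> connected_pts (f x0) (\<phi> g y)" "\<not> connected_pts (f x0) (f y)"
      using x0 connected_pts_coarse[OF f(1)] connected_pts_coarse[OF coarse_equivalence_act[OF gG]]
        y disconn(1) connected_pts_trans by meson+
    then show ?thesis
      using two_components(1)[OF oe disconn] fX y disconn(1) act_closed[OF gG] by blast
  qed
  \<comment> \<open>Pointwise finite distance is enough for closeness, because here that relation is
    controlled as a whole.\<close>
  then have "ls_close X L (\<phi> g) f"
    unfolding close_iff_controlled
    by (intro controlled_mono[OF two_components(2)[OF oe disconn]]) auto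
  then show ?thesis
    using gG by blast
qed

end

section \<open>The isomorphism\<close>

theorem theorem4p8:
  fixes X :: "'a set" and L :: "'a set set set"
    and G :: "('g, 'm) monoid_scheme" and \<phi> :: "'g \<Rightarrow> 'a \<Rightarrow> 'a"
  assumes "large_scale_space X L"
    and "\<not> ls_bounded L X"
    and "group G"
    and "acts_by_coarse_equivalences G X L \<phi>"
    and "coarsely_discontinuous G L \<phi>"
    and "coarsely_one_ended X L"
  shows "group (coarse_Aut X L (quotient_ls G X L \<phi>)) \<and>
    (\<lambda>g. coarse_aut_class X L (quotient_ls G X L \<phi>) (\<phi> g))
      \<in> iso G (coarse_Aut X L (quotient_ls G X L \<phi>))"
proof -
  interpret coarse_action X L G \<phi>
    using assms(1,4)
    by (simp add: coarse_action_def coarse_action_axioms_def acts_by_coarse_equivalences_def)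
  show ?thesis
  proof (rule group_coarse_Aut)
    fix f assume "f \<in> maps"
    then have f: "coarse_equivalence X L X L f" "ls_close X LG f (\<lambda>x. x)"
      by (rule mapsD)+
    show "\<exists>g\<in>carrier G. ls_close X L (\<phi> g) f"
    \<comment> \<open>Either all points are at finite distance from each other, or there are exactly
      two coarse components.\<close>
    proof (cases "\<forall>x\<in>X. \<forall>y\<in>X. controlled L {(x, y)}")
      case True
      then show ?thesis
        using assms f by (intro close_act_connected) (auto simp: coarse_equivalence_def)
    next
      case False
      then show ?thesis
        using close_act_disconnected[OF assms(6) _ _ _ f] by blast
    qed
  next
    fix g h assume "g \<in> carrier G" "h \<in> carrier G" "ls_close X L (\<phi> g) (\<phi> h)"
    then show "g = h"
      using act_close_imp_eq assms by blast
  qed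
qed

end
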